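(* Assume that for all $k\in\{1,\dots,K\}$ the cumulative distribution function $F_{p_k}$ of $p_k(X)$ is continuous. For any $\beta\in(0,K)$, both of the following hold. 1. The Oracle $\beta$-set $\Gamma_\beta^*$ satisfies $$\mathcal{R}(\Gamma_\beta^* )=\inf_{\Gamma}\mathcal{R}(\Gamma),$$ where the infimum is taken over all confidence sets $\Gamma$ with $\mathcal{I}(\Gamma)=\beta$ (the $\beta$-level confidence sets). 2. For any confidence set $\Gamma$ with $\mathcal{I}(\Gamma)=\beta$, $$0\le \mathcal{R}(\Gamma)-\mathcal{R}(\Gamma_\beta^* )=\mathbb{E}\left[\sum_{k\in(\Gamma_\beta^*(X)\,\Delta\,\Gamma(X))}\left|p_k(X)-G^{-1}(\beta)\right|\right],$$ where $A\,\Delta\,B=(A\setminus B)\cup(B\setminus A)$ for subsets $A,B$ of $\{1,\dots,K\}$.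
   Context: Let $K\ge 2$ be an integer, $\mathcal{Y}=\{1,\dots,K\}$, and let $(X,Y)$ be a random pair with values in $\mathcal{X}\times\mathcal{Y}$ and distribution $\mathbb{P}$. For $k\in\mathcal{Y}$ put $p_k(x)=\mathbb{P}(Y=k\mid X=x)$. A confidence set is a measurable map $\Gamma:\mathcal{X}\to 2^{\mathcal{Y}}$; its risk is $\mathcal{R}(\Gamma)=\mathbb{P}(Y\notin\Gamma(X))$ and its information is $\mathcal{I}(\Gamma)=\mathbb{E}[|\Gamma(X)|]$, where $|\cdot|$ is cardinality. With $F_{p_k}$ the c.d.f. of $p_k(X)$ and $\bar F_{p_k}=1-F_{p_k}$, define $G(t)=\sum_{k=1}^K\bar F_{p_k}(t)$ for $t\in[0,1]$ and the generalized inverse $G^{-1}(\beta)=\inf\{t\in[0,1]: G(t)\le\beta\}$ for $\beta\in(0,K)$. The Oracle $\beta$-set is $\Gamma_\beta^*(X)=\{k\in\{1,\dots,K\}: G(p_k(X))\le\beta\}=\{k: p_k(X)\ge G^{-1}(\beta)\}$. *)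

theory Defs
  imports "HOL-Probability.Probability"
begin

text \<open>
  \<open>q\<close> is a version of \<open>x \<mapsto> P(E | X = x)\<close>: a measurable function on the range of \<open>X\<close> whose
  composition with \<open>X\<close> is the conditional expectation of the indicator of \<open>E\<close> given \<open>\<sigma>(X)\<close>.
  Such a function is determined only up to null sets of the law of \<open>X\<close>.
\<close>

definition cond_prob_version ::
  "'w measure \<Rightarrow> 'x measure \<Rightarrow> ('w \<Rightarrow> 'x) \<Rightarrow> 'w set \<Rightarrow> ('x \<Rightarrow> real) \<Rightarrow> bool" where
  "cond_prob_version M S X E q \<longleftrightarrow>
     q \<in> borel_measurable S \<and>
     (AE w in M. q (X w) = real_cond_exp M (vimage_algebra (space M) X S) (indicator E) w)"

definition confidence_sets :: "'x measure \<Rightarrow> nat \<Rightarrow> ('x \<Rightarrow> nat set) set" where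
  "confidence_sets S K = measurable S (count_space (Pow {1..K}))"

definition risk :: "'w measure \<Rightarrow> ('w \<Rightarrow> 'x) \<Rightarrow> ('w \<Rightarrow> nat) \<Rightarrow> ('x \<Rightarrow> nat set) \<Rightarrow> real" where
  "risk M X Y \<Gamma> = measure M {w \<in> space M. Y w \<notin> \<Gamma> (X w)}"

definition info :: "'w measure \<Rightarrow> ('w \<Rightarrow> 'x) \<Rightarrow> ('x \<Rightarrow> nat set) \<Rightarrow> real" where
  "info M X \<Gamma> = (\<integral>w. real (card (\<Gamma> (X w))) \<partial>M)"

definition score_cdf ::
  "'w measure \<Rightarrow> ('w \<Rightarrow> 'x) \<Rightarrow> (nat \<Rightarrow> 'x \<Rightarrow> real) \<Rightarrow> nat \<Rightarrow> real \<Rightarrow> real" where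
  "score_cdf M X p k = cdf (distr M borel (\<lambda>w. p k (X w)))"

definition G_fun ::
  "'w measure \<Rightarrow> ('w \<Rightarrow> 'x) \<Rightarrow> nat \<Rightarrow> (nat \<Rightarrow> 'x \<Rightarrow> real) \<Rightarrow> real \<Rightarrow> real" where
  "G_fun M X K p t = (\<Sum>k=1..K. 1 - score_cdf M X p k t)"

definition G_inv ::
  "'w measure \<Rightarrow> ('w \<Rightarrow> 'x) \<Rightarrow> nat \<Rightarrow> (nat \<Rightarrow> 'x \<Rightarrow> real) \<Rightarrow> real \<Rightarrow> real" where
  "G_inv M X K p \<beta> = Inf {t \<in> {0..1}. G_fun M X K p t \<le> \<beta>}"

text \<open>
  When all the functions \<open>score_cdf M X p k\<close> are continuous, \<open>G_fun\<close> is continuous and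
  nonincreasing, equal to \<open>K\<close> at 0 and to 0 at 1, so for \<open>0 < \<beta> < K\<close> the condition below is
  equivalent to \<open>p k x \<ge> G_inv M X K p \<beta>\<close>.
\<close>

definition oracle_set ::
  "'w measure \<Rightarrow> ('w \<Rightarrow> 'x) \<Rightarrow> nat \<Rightarrow> (nat \<Rightarrow> 'x \<Rightarrow> real) \<Rightarrow> real \<Rightarrow> 'x \<Rightarrow> nat set" where
  "oracle_set M X K p \<beta> x = {k \<in> {1..K}. G_fun M X K p (p k x) \<le> \<beta>}"

end

theory Submission
  imports Defs
begin

text \<open>
  Put \<open>s = G\<^sup>-\<^sup>1(\<beta>)\<close>. Continuity of the score distributions gives \<open>G(s) = \<beta>\<close>, shows that
  the oracle set is \<open>{k. s \<le> p\<^sub>k}\<close>, and shows that it has information exactly \<open>\<beta>\<close>. Conditioning on \<open>X\<close>,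
  the risk of \<open>\<Gamma>\<close> is \<open>1 - \<Sum>\<^sub>k E[p\<^sub>k(X) 1(k \<in> \<Gamma>(X))]\<close>. For \<open>\<Gamma>\<close> of information \<open>\<beta>\<close>, one may
  replace \<open>p\<^sub>k\<close> by \<open>p\<^sub>k - s\<close> in the difference of two risks, and
  \<open>(p\<^sub>k - s) (1(s \<le> p\<^sub>k) - 1(k \<in> \<Gamma>))\<close> equals \<open>\<bar>p\<^sub>k - s\<bar>\<close> on the symmetric difference and 0 off it.
\<close>

section \<open>Measurability of set-valued maps into a finite label set\<close>

lemma confidence_sets_subset:
  assumes "\<Gamma> \<in> confidence_sets S K" "x \<in> space S"
  shows "\<Gamma> x \<subseteq> {1..K}"
  using measurable_space[of \<Gamma> S "count_space (Pow {1..K})" x] assms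
  unfolding confidence_sets_def by auto

text \<open>Reduces measurability of a set-valued map to that of its \<open>K\<close> membership
  predicates, the form in which both the oracle set and the integrands below are handled.\<close>

lemma confidence_sets_iff:
  "\<Gamma> \<in> confidence_sets S K \<longleftrightarrow>
     (\<forall>x \<in> space S. \<Gamma> x \<subseteq> {1..K}) \<and> (\<forall>k \<in> {1..K}. {x \<in> space S. k \<in> \<Gamma> x} \<in> sets S)"
proof (intro iffI conjI ballI)
  assume \<Gamma>: "\<Gamma> \<in> confidence_sets S K"
  show "\<Gamma> x \<subseteq> {1..K}" if "x \<in> space S" for x
    using \<Gamma> that by (rule confidence_sets_subset)
  fix k assume "k \<in> {1..K}"
  have "\<Gamma> -` {A \<in> Pow {1..K}. k \<in> A} \<inter> space S \<in> sets S"
    using \<Gamma> unfolding confidence_sets_def by (rule measurable_sets) auto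
  moreover have "\<Gamma> -` {A \<in> Pow {1..K}. k \<in> A} \<inter> space S = {x \<in> space S. k \<in> \<Gamma> x}"
    using confidence_sets_subset[OF \<Gamma>] by auto
  ultimately show "{x \<in> space S. k \<in> \<Gamma> x} \<in> sets S" by simp
next
  assume *: "(\<forall>x \<in> space S. \<Gamma> x \<subseteq> {1..K}) \<and> (\<forall>k \<in> {1..K}. {x \<in> space S. k \<in> \<Gamma> x} \<in> sets S)"
  \<comment> \<open>\<open>Pow {1..K}\<close> is finite, so preimages of singletons suffice, and
    each of these is a finite conjunction of membership conditions.\<close>
  have "\<Gamma> -` {A} \<inter> space S \<in> sets S" if "A \<subseteq> {1..K}" for A
  proof -
    have meas: "Measurable.pred S (\<lambda>x. k \<in> \<Gamma> x)" if "k \<in> {1..K}" for k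
      using * that by (simp add: pred_def)
    have "Measurable.pred S (\<lambda>x. \<forall>k \<in> {1..K}. (k \<in> \<Gamma> x) = (k \<in> A))"
      using meas by (intro pred_intros_finite pred_intros_logic) auto
    moreover have "\<Gamma> -` {A} \<inter> space S = {x \<in> space S. \<forall>k \<in> {1..K}. (k \<in> \<Gamma> x) = (k \<in> A)}"
      using * that by blast
    ultimately show ?thesis by (simp add: pred_def)
  qed
  with * show "\<Gamma> \<in> confidence_sets S K"
    unfolding confidence_sets_def by (subst measurable_count_space_eq2) auto
qed

section \<open>Conditional probabilities given \<open>X\<close>\<close>

context prob_space
begin

lemma finite_measure_subalgebra_vimage_algebra:
  assumes "X \<in> measurable M S"
  shows "finite_measure_subalgebra M (vimage_algebra (space M) X S)"
proof
  show "subalgebra M (vimage_algebra (space M) X S)"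
    using assms sets_image_in_sets[OF refl assms] by (auto simp: subalgebra_def)
qed

text \<open>The indicator of \<open>E\<close> lies between 0 and 1, and conditional expectation
  preserves constant bounds almost everywhere. A version may be arbitrary on null sets, so the
  bounds cannot hold pointwise.\<close>

lemma cond_prob_version_bounds:
  assumes X: "X \<in> measurable M S" and E: "E \<in> events" and q: "cond_prob_version M S X E q"
  shows "AE w in M. 0 \<le> q (X w) \<and> q (X w) \<le> 1"
proof -
  interpret finite_measure_subalgebra M "vimage_algebra (space M) X S"
    using X by (rule finite_measure_subalgebra_vimage_algebra)
  have int: "integrable M (indicator E :: _ \<Rightarrow> real)"
    using E by (simp add: emeasure_eq_measure)
  have "AE w in M. real_cond_exp M (vimage_algebra (space M) X S) (indicator E) w \<ge> 0"
    using int by (rule real_cond_exp_ge_c) auto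
  moreover have "AE w in M. real_cond_exp M (vimage_algebra (space M) X S) (indicator E) w \<le> 1"
    using int by (rule real_cond_exp_le_c) (auto simp: indicator_def)
  ultimately show ?thesis
    using q unfolding cond_prob_version_def by auto
qed

text \<open>The event that \<open>P (X w)\<close> holds belongs to the sigma-algebra generated by
  \<open>X\<close>, so integrating the indicator of \<open>E\<close> over it is the same as
  integrating the conditional expectation.\<close>

lemma cond_prob_version_prob:
  assumes X: "X \<in> measurable M S" and E: "E \<in> events" and q: "cond_prob_version M S X E q"
    and A: "{x \<in> space S. P x} \<in> sets S"
  shows "prob {w \<in> E. P (X w)} = (\<integral>w. q (X w) * of_bool (P (X w)) \<partial>M)"
proof -
  interpret finite_measure_subalgebra M "vimage_algebra (space M) X S"
    using X by (rule finite_measure_subalgebra_vimage_algebra)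
  let ?B = "X -` {x \<in> space S. P x} \<inter> space M"
  have [measurable]: "X \<in> measurable M S" "q \<in> borel_measurable S" "Measurable.pred S P"
    using X q A by (auto simp: cond_prob_version_def pred_def)
  have int: "integrable M (indicator E :: _ \<Rightarrow> real)"
    using E by (simp add: emeasure_eq_measure)
  have B: "?B \<in> sets (vimage_algebra (space M) X S)"
    using A by (rule in_vimage_algebra)
  have eq: "{w \<in> E. P (X w)} = E \<inter> ?B"
    using sets.sets_into_space[OF E] measurable_space[OF X] by auto
  have "prob {w \<in> E. P (X w)} = (\<integral>w\<in>?B. indicator E w \<partial>M)"
    using sets.sets_into_space[OF E]
    by (simp add: eq set_lebesgue_integral_def flip: indicator_inter_arith)
      (auto intro!: arg_cong[of _ _ prob])
  also have "\<dots> = (\<integral>w\<in>?B. real_cond_exp M (vimage_algebra (space M) X S) (indicator E) w \<partial>M)"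
    using int B by (rule real_cond_exp_intA)
  also have "\<dots> = (\<integral>w. q (X w) * of_bool (P (X w)) \<partial>M)"
    unfolding set_lebesgue_integral_def
  proof (rule integral_cong_AE)
    show "(\<lambda>w. indicator ?B w *\<^sub>R real_cond_exp M (vimage_algebra (space M) X S) (indicator E) w)
        \<in> borel_measurable M"
      by measurable
    show "AE w in M. indicator ?B w *\<^sub>R
        real_cond_exp M (vimage_algebra (space M) X S) (indicator E) w
        = q (X w) * of_bool (P (X w))"
      using q[unfolded cond_prob_version_def, THEN conjunct2] AE_space
      by eventually_elim (use measurable_space[OF X] in \<open>auto simp: indicator_def\<close>)
  qed measurable
  finally show ?thesis .
qed

end

section \<open>Risk and information as sums over labels\<close>

locale scored_classification = prob_space M
  for M :: "'w measure" +
  fixes S :: "'x measure" and X :: "'w \<Rightarrow> 'x" and Y :: "'w \<Rightarrow> nat"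
    and K :: nat and p :: "nat \<Rightarrow> 'x \<Rightarrow> real"
  assumes X_measurable [measurable]: "X \<in> measurable M S"
    and Y_measurable: "Y \<in> measurable M (count_space {1..K})"
    and cond_prob: "\<And>k. k \<in> {1..K} \<Longrightarrow> cond_prob_version M S X {w \<in> space M. Y w = k} (p k)"
begin

lemma p_measurable [measurable]: "k \<in> {1..K} \<Longrightarrow> p k \<in> borel_measurable S"
  using cond_prob by (simp add: cond_prob_version_def)

lemma Y_event: "k \<in> {1..K} \<Longrightarrow> {w \<in> space M. Y w = k} \<in> events"
  using measurable_sets[OF Y_measurable, of "{k}"]
  by (auto simp: vimage_def Int_def conj_commute)

lemma score_bounds:
  assumes "k \<in> {1..K}"
  shows "AE w in M. 0 \<le> p k (X w) \<and> p k (X w) \<le> 1"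
  using X_measurable Y_event[OF assms] cond_prob[OF assms] by (rule cond_prob_version_bounds)

lemma integrable_score_indicator:
  assumes k: "k \<in> {1..K}" and A: "{x \<in> space S. P x} \<in> sets S"
  shows "integrable M (\<lambda>w. p k (X w) * of_bool (P (X w)))"
proof (rule integrable_const_bound[where B = 1])
  note [measurable] = p_measurable[OF k]
  have [measurable]: "Measurable.pred S P" using A by (simp add: pred_def)
  show "(\<lambda>w. p k (X w) * of_bool (P (X w))) \<in> borel_measurable M" by measurable
  show "AE w in M. norm (p k (X w) * of_bool (P (X w))) \<le> 1"
    using score_bounds[OF k] by eventually_elim auto
qed

lemma integrable_of_bool:
  assumes A: "{x \<in> space S. P x} \<in> sets S"
  shows "integrable M (\<lambda>w. of_bool (P (X w)) :: real)"
proof (rule integrable_const_bound[where B = 1])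
  have [measurable]: "Measurable.pred S P" using A by (simp add: pred_def)
  show "(\<lambda>w. of_bool (P (X w)) :: real) \<in> borel_measurable M" by measurable
qed auto

lemma expectation_of_bool:
  assumes A: "{x \<in> space S. P x} \<in> sets S"
  shows "(\<integral>w. of_bool (P (X w)) \<partial>M) = prob {w \<in> space M. P (X w)}"
proof -
  have "(\<integral>w. of_bool (P (X w)) \<partial>M) = (\<integral>w. indicator {w \<in> space M. P (X w)} w \<partial>M :: real)"
    by (rule Bochner_Integration.integral_cong) (auto simp: indicator_def)
  also have "\<dots> = prob {w \<in> space M. P (X w)}"
    by (simp add: Int_absorb2)
  finally show ?thesis .
qed

lemma info_eq:
  assumes \<Gamma>: "\<Gamma> \<in> confidence_sets S K"
  shows "info M X \<Gamma> = (\<Sum>k=1..K. \<integral>w. of_bool (k \<in> \<Gamma> (X w)) \<partial>M)"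
proof -
  have "info M X \<Gamma> = (\<integral>w. (\<Sum>k=1..K. of_bool (k \<in> \<Gamma> (X w))) \<partial>M)"
    unfolding info_def
  proof (rule Bochner_Integration.integral_cong)
    fix w assume "w \<in> space M"
    then have "\<Gamma> (X w) \<subseteq> {1..K}"
      using confidence_sets_subset[OF \<Gamma>] measurable_space[OF X_measurable] by blast
    then have "{1..K} \<inter> {k. k \<in> \<Gamma> (X w)} = \<Gamma> (X w)" by auto
    then show "real (card (\<Gamma> (X w))) = (\<Sum>k=1..K. of_bool (k \<in> \<Gamma> (X w)))"
      by (simp add: sum_of_bool_eq)
  qed simp
  also have "\<dots> = (\<Sum>k=1..K. \<integral>w. of_bool (k \<in> \<Gamma> (X w)) \<partial>M)"
    using \<Gamma> by (intro Bochner_Integration.integral_sum integrable_of_bool) (simp add: confidence_sets_iff)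
  finally show ?thesis .
qed

text \<open>Since \<open>Y\<close> takes values in \<open>{1..K}\<close>, the complement of the
  error event is the disjoint union over \<open>k\<close> of the events \<open>Y = k\<close> with
  \<open>k\<close> in the confidence set. Each of these is evaluated by conditioning on
  \<open>X\<close>.\<close>

lemma risk_eq:
  assumes \<Gamma>: "\<Gamma> \<in> confidence_sets S K"
  shows "risk M X Y \<Gamma> = 1 - (\<Sum>k=1..K. \<integral>w. p k (X w) * of_bool (k \<in> \<Gamma> (X w)) \<partial>M)"
proof -
  let ?H = "\<lambda>k. {w \<in> {w \<in> space M. Y w = k}. k \<in> \<Gamma> (X w)}"
  have H: "?H k \<in> events" if "k \<in> {1..K}" for k
  proof -
    have "Measurable.pred S (\<lambda>x. k \<in> \<Gamma> x)" "Measurable.pred M (\<lambda>w. Y w = k)"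
      using \<Gamma> that Y_event[OF that] by (auto simp: confidence_sets_iff pred_def)
    note [measurable] = this
    show ?thesis by measurable
  qed
  have Y_range: "Y w \<in> {1..K}" if "w \<in> space M" for w
    using measurable_space[OF Y_measurable that] by simp
  have "{w \<in> space M. Y w \<notin> \<Gamma> (X w)} = space M - (\<Union>k\<in>{1..K}. ?H k)"
    using Y_range by auto
  then have "risk M X Y \<Gamma> = 1 - prob (\<Union>k\<in>{1..K}. ?H k)"
    unfolding risk_def using H by (simp only:) (intro prob_compl, auto)
  also have "prob (\<Union>k\<in>{1..K}. ?H k) = (\<Sum>k=1..K. prob (?H k))"
    using H by (intro finite_measure_finite_Union) (auto simp: disjoint_family_on_def)
  also have "\<dots> = (\<Sum>k=1..K. \<integral>w. p k (X w) * of_bool (k \<in> \<Gamma> (X w)) \<partial>M)"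
  proof (rule sum.cong)
    fix k assume k: "k \<in> {1..K}"
    show "prob (?H k) = (\<integral>w. p k (X w) * of_bool (k \<in> \<Gamma> (X w)) \<partial>M)"
      using X_measurable Y_event[OF k] cond_prob[OF k]
      by (rule cond_prob_version_prob) (use \<Gamma> k in \<open>simp add: confidence_sets_iff\<close>)
  qed simp
  finally show ?thesis .
qed

lemma score_cdf_eq:
  assumes "k \<in> {1..K}"
  shows "score_cdf M X p k t = prob {w \<in> space M. p k (X w) \<le> t}"
proof -
  note [measurable] = p_measurable[OF assms]
  show ?thesis
    unfolding score_cdf_def cdf_def
    by (subst measure_distr) (auto simp: vimage_def Int_def conj_commute)
qed

end

section \<open>Atomless score distributions, the function \<open>G\<close> and its inverse\<close>

locale continuous_scores = scored_classification +
  assumes score_cdf_continuous: "\<And>k. k \<in> {1..K} \<Longrightarrow> continuous_on UNIV (score_cdf M X p k)"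
begin

text \<open>The jump of a distribution function at \<open>t\<close> is the mass of the point
  \<open>t\<close>, so continuity excludes atoms.\<close>

lemma AE_score_neq:
  assumes k: "k \<in> {1..K}"
  shows "AE w in M. p k (X w) \<noteq> t"
proof -
  note [measurable] = p_measurable[OF k]
  interpret D: real_distribution "distr M borel (\<lambda>w. p k (X w))"
    by (intro real_distribution_distr) measurable
  have "isCont (score_cdf M X p k) t"
    using score_cdf_continuous[OF k] by (simp add: continuous_on_eq_continuous_at)
  then have "measure (distr M borel (\<lambda>w. p k (X w))) {t} = 0"
    by (simp add: score_cdf_def D.isCont_cdf)
  then have "prob {w \<in> space M. p k (X w) = t} = 0"
    by (subst (asm) measure_distr) (auto simp: vimage_def Int_def conj_commute)
  then show ?thesis
    by (subst (asm) prob_eq_0) auto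
qed

lemma score_cdf_nonpos:
  assumes k: "k \<in> {1..K}" and "t \<le> 0"
  shows "score_cdf M X p k t = 0"
proof -
  note [measurable] = p_measurable[OF k]
  \<comment> \<open>The score bounds give only \<open>0 \<le> p k (X w)\<close>; the absence of an
    atom at 0 makes this strict, which the case \<open>t = 0\<close> requires.\<close>
  have "AE w in M. \<not> p k (X w) \<le> t"
    using score_bounds[OF k] AE_score_neq[OF k, of 0] by eventually_elim (use \<open>t \<le> 0\<close> in auto)
  then show ?thesis
    unfolding score_cdf_eq[OF k] by (subst prob_eq_0) auto
qed

lemma score_cdf_ge_1:
  assumes k: "k \<in> {1..K}" and "1 \<le> t"
  shows "score_cdf M X p k t = 1"
proof -
  note [measurable] = p_measurable[OF k]
  have "AE w in M. p k (X w) \<le> t"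
    using score_bounds[OF k] by eventually_elim (use \<open>1 \<le> t\<close> in auto)
  then show ?thesis
    unfolding score_cdf_eq[OF k] by (subst prob_Collect_eq_1) auto
qed

lemma score_cdf_mono:
  assumes k: "k \<in> {1..K}" and "t \<le> u"
  shows "score_cdf M X p k t \<le> score_cdf M X p k u"
proof -
  note [measurable] = p_measurable[OF k]
  show ?thesis
    unfolding score_cdf_eq[OF k] by (rule finite_measure_mono) (use \<open>t \<le> u\<close> in auto)
qed

abbreviation "G \<equiv> G_fun M X K p"
abbreviation "Ginv \<equiv> G_inv M X K p"

lemma G_nonpos: "t \<le> 0 \<Longrightarrow> G t = K"
  by (simp add: G_fun_def score_cdf_nonpos)

lemma G_ge_1: "1 \<le> t \<Longrightarrow> G t = 0"
  by (simp add: G_fun_def score_cdf_ge_1)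

lemma G_antimono: "t \<le> u \<Longrightarrow> G u \<le> G t"
  unfolding G_fun_def by (intro sum_mono diff_mono score_cdf_mono) auto

lemma G_continuous: "continuous_on A G"
  unfolding G_fun_def
  by (intro continuous_intros) (use score_cdf_continuous continuous_on_subset in blast)

text \<open>The infimum is attained: the sublevel set is closed because \<open>G\<close> is
  continuous, and it contains 1, where \<open>G\<close> vanishes.\<close>

lemma Ginv_mem:
  fixes \<beta> :: real
  assumes "0 < \<beta>"
  shows "Ginv \<beta> \<in> {t \<in> {0..1}. G t \<le> \<beta>}"
  unfolding G_inv_def
proof (rule closed_contains_Inf)
  show "{t \<in> {0..1}. G t \<le> \<beta>} \<noteq> {}"
    using assms G_ge_1[of 1] by force
  show "bdd_below {t \<in> {0..1}. G t \<le> \<beta>}" by (rule bdd_belowI[of _ 0]) auto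
  show "closed {t \<in> {0..1}. G t \<le> \<beta>}"
    using continuous_on_closed_Collect_le[OF G_continuous continuous_on_const, of "{0..1}" \<beta>]
    by simp
qed

lemma Ginv_le: "t \<in> {0..1} \<Longrightarrow> G t \<le> \<beta> \<Longrightarrow> Ginv \<beta> \<le> t"
  unfolding G_inv_def by (intro cInf_lower bdd_belowI[of _ 0]) auto

lemma G_Ginv:
  assumes "0 < \<beta>" "\<beta> < real K"
  shows "G (Ginv \<beta>) = \<beta>"
proof -
  have s: "0 \<le> Ginv \<beta>" "Ginv \<beta> \<le> 1" "G (Ginv \<beta>) \<le> \<beta>"
    using Ginv_mem[OF assms(1)] by auto
  \<comment> \<open>Intermediate values between \<open>G 0 = K\<close>, which exceeds
    \<open>\<beta>\<close>, and \<open>G (Ginv \<beta>) \<le> \<beta>\<close>. The resulting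
    \<open>t\<close> lies in the sublevel set, so it cannot be smaller than the infimum.\<close>
  have "\<exists>t\<ge>0. t \<le> Ginv \<beta> \<and> G t = \<beta>"
    using s assms G_nonpos[of 0] by (intro IVT2' G_continuous) auto
  then obtain t where t: "0 \<le> t" "t \<le> Ginv \<beta>" "G t = \<beta>" by auto
  moreover have "Ginv \<beta> \<le> t" using t s by (intro Ginv_le) auto
  ultimately show ?thesis by simp
qed

\<comment> \<open>Versions \<open>p k\<close> may leave \<open>[0, 1]\<close> on a null set, so \<open>t\<close> ranges over all reals.\<close>
lemma G_le_iff:
  assumes "0 < \<beta>" "\<beta> < real K"
  shows "G t \<le> \<beta> \<longleftrightarrow> Ginv \<beta> \<le> t"
proof
  assume "G t \<le> \<beta>"
  then have "0 < t" using G_nonpos[of t] assms by linarith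
  \<comment> \<open>For \<open>t \<le> 1\<close> the infimum is a lower bound; for larger
    \<open>t\<close> the bound \<open>Ginv \<beta> \<le> 1\<close> suffices.\<close>
  then show "Ginv \<beta> \<le> t"
    using Ginv_le[of t \<beta>] Ginv_mem[OF assms(1)] \<open>G t \<le> \<beta>\<close> by fastforce
next
  assume "Ginv \<beta> \<le> t"
  then show "G t \<le> \<beta>" using G_antimono G_Ginv[OF assms] by metis
qed

section \<open>Information and excess risk relative to the oracle set\<close>

lemma oracle_set_eq:
  assumes "0 < \<beta>" "\<beta> < real K"
  shows "oracle_set M X K p \<beta> x = {k \<in> {1..K}. Ginv \<beta> \<le> p k x}"
  unfolding oracle_set_def G_le_iff[OF assms] ..

lemma oracle_set_confidence_set:
  assumes "0 < \<beta>" "\<beta> < real K"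
  shows "oracle_set M X K p \<beta> \<in> confidence_sets S K"
  unfolding confidence_sets_iff oracle_set_eq[OF assms]
proof (intro conjI ballI)
  fix k assume k: "k \<in> {1..K}"
  note [measurable] = p_measurable[OF k]
  show "{x \<in> space S. k \<in> {k \<in> {1..K}. Ginv \<beta> \<le> p k x}} \<in> sets S"
    using k by simp
qed auto

text \<open>Membership of \<open>k\<close> has the probability that the score is at least
  \<open>Ginv \<beta>\<close>, while \<open>G\<close> sums probabilities of strict excess. Without
  atoms the two agree, so the information is \<open>G (Ginv \<beta>) = \<beta>\<close>.\<close>

lemma info_oracle_set:
  assumes "0 < \<beta>" "\<beta> < real K"
  shows "info M X (oracle_set M X K p \<beta>) = \<beta>"
proof -
  let ?O = "oracle_set M X K p \<beta>"
  have conf: "?O \<in> confidence_sets S K" using assms by (rule oracle_set_confidence_set)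
  have "(\<integral>w. of_bool (k \<in> ?O (X w)) \<partial>M) = 1 - score_cdf M X p k (Ginv \<beta>)"
    if k: "k \<in> {1..K}" for k
  proof -
    note [measurable] = p_measurable[OF k]
    have "(\<integral>w. of_bool (k \<in> ?O (X w)) \<partial>M) = prob {w \<in> space M. Ginv \<beta> \<le> p k (X w)}"
      using conf k by (subst expectation_of_bool) (auto simp: confidence_sets_iff oracle_set_eq[OF assms])
    also have "\<dots> = prob {w \<in> space M. \<not> p k (X w) \<le> Ginv \<beta>}"
      by (rule finite_measure_eq_AE) (use AE_score_neq[OF k, of "Ginv \<beta>"] in auto)
    also have "\<dots> = 1 - score_cdf M X p k (Ginv \<beta>)"
      unfolding score_cdf_eq[OF k] by (rule prob_neg) measurable
    finally show ?thesis .
  qed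
  then have "info M X ?O = G (Ginv \<beta>)"
    unfolding info_eq[OF conf] G_fun_def by (intro sum.cong) auto
  with G_Ginv[OF assms] show ?thesis by simp
qed

lemma excess_risk:
  assumes \<beta>: "0 < \<beta>" "\<beta> < real K" and \<Gamma>: "\<Gamma> \<in> confidence_sets S K" and info: "info M X \<Gamma> = \<beta>"
  shows "risk M X Y \<Gamma> - risk M X Y (oracle_set M X K p \<beta>)
    = (\<integral>w. (\<Sum>k \<in> sym_diff (oracle_set M X K p \<beta> (X w)) (\<Gamma> (X w)). \<bar>p k (X w) - Ginv \<beta>\<bar>) \<partial>M)"
proof -
  let ?O = "oracle_set M X K p \<beta>" and ?s = "Ginv \<beta>"
  let ?o = "\<lambda>k w. of_bool (k \<in> ?O (X w)) :: real" and ?c = "\<lambda>k w. of_bool (k \<in> \<Gamma> (X w)) :: real"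
  have conf: "?O \<in> confidence_sets S K" using \<beta> by (rule oracle_set_confidence_set)
  have int: "integrable M (?o k)" "integrable M (?c k)"
    "integrable M (\<lambda>w. p k (X w) * ?o k w)" "integrable M (\<lambda>w. p k (X w) * ?c k w)"
    if "k \<in> {1..K}" for k
    using conf \<Gamma> that
    by (auto simp: confidence_sets_iff intro!: integrable_of_bool integrable_score_indicator)
  have "(\<Sum>k=1..K. \<integral>w. ?o k w \<partial>M) = (\<Sum>k=1..K. \<integral>w. ?c k w \<partial>M)"
    using info_eq[OF conf] info_eq[OF \<Gamma>] info info_oracle_set[OF \<beta>] by simp
  \<comment> \<open>The term multiplied by \<open>?s\<close> is zero because both sets have
    information \<open>\<beta>\<close>; it is inserted to centre the scores at the
    threshold.\<close>
  then have "risk M X Y \<Gamma> - risk M X Y ?O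
    = (\<Sum>k=1..K. (\<integral>w. p k (X w) * ?o k w \<partial>M)) - (\<Sum>k=1..K. (\<integral>w. p k (X w) * ?c k w \<partial>M))
      - ?s * ((\<Sum>k=1..K. \<integral>w. ?o k w \<partial>M) - (\<Sum>k=1..K. \<integral>w. ?c k w \<partial>M))"
    unfolding risk_eq[OF conf] risk_eq[OF \<Gamma>] by simp
  also have "\<dots> = (\<Sum>k=1..K. (\<integral>w. p k (X w) * ?o k w \<partial>M) - (\<integral>w. p k (X w) * ?c k w \<partial>M)
      - ?s * ((\<integral>w. ?o k w \<partial>M) - (\<integral>w. ?c k w \<partial>M)))"
    by (simp only: sum_subtractf sum_distrib_left[symmetric])
  also have "\<dots> = (\<Sum>k=1..K. \<integral>w. p k (X w) * ?o k w - p k (X w) * ?c k w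
      - ?s * (?o k w - ?c k w) \<partial>M)"
    by (intro sum.cong refl) (simp add: int)
  also have "\<dots> = (\<integral>w. (\<Sum>k=1..K. p k (X w) * ?o k w - p k (X w) * ?c k w
      - ?s * (?o k w - ?c k w)) \<partial>M)"
    by (intro Bochner_Integration.integral_sum[symmetric] Bochner_Integration.integrable_diff
        integrable_mult_right int)
  also have "\<dots> = (\<integral>w. (\<Sum>k \<in> sym_diff (?O (X w)) (\<Gamma> (X w)). \<bar>p k (X w) - ?s\<bar>) \<partial>M)"
  proof (rule Bochner_Integration.integral_cong)
    fix w assume "w \<in> space M"
    then have \<Gamma>_sub: "\<Gamma> (X w) \<subseteq> {1..K}"
      using confidence_sets_subset[OF \<Gamma>] measurable_space[OF X_measurable] by blast
    then have sub: "sym_diff (?O (X w)) (\<Gamma> (X w)) \<subseteq> {1..K}"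
      by (auto simp: oracle_set_eq[OF \<beta>])
    show "(\<Sum>k=1..K. p k (X w) * ?o k w - p k (X w) * ?c k w - ?s * (?o k w - ?c k w))
      = (\<Sum>k \<in> sym_diff (?O (X w)) (\<Gamma> (X w)). \<bar>p k (X w) - ?s\<bar>)"
      \<comment> \<open>Labels on which the two sets agree contribute 0. A label only in the oracle
        set has score at least \<open>?s\<close>; one only in \<open>\<Gamma> (X w)\<close> has
        score below \<open>?s\<close> and a negative coefficient, so both give the absolute
        value.\<close>
      by (rule sum.mono_neutral_cong_right[OF _ sub])
        (use \<Gamma>_sub in \<open>auto simp: oracle_set_eq[OF \<beta>]\<close>)
  qed simp
  finally show ?thesis .
qed

end

theorem proposition2:
  fixes M :: "'w measure" and S :: "'x measure"
    and X :: "'w \<Rightarrow> 'x" and Y :: "'w \<Rightarrow> nat"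
    and K :: nat and p :: "nat \<Rightarrow> 'x \<Rightarrow> real" and \<beta> :: real
  assumes "prob_space M"
    and "2 \<le> K"
    and "X \<in> measurable M S"
    and "Y \<in> measurable M (count_space {1..K})"
    and "\<And>k. k \<in> {1..K} \<Longrightarrow> cond_prob_version M S X {w \<in> space M. Y w = k} (p k)"
    and "\<And>k. k \<in> {1..K} \<Longrightarrow> continuous_on UNIV (score_cdf M X p k)"
    and "0 < \<beta>" and "\<beta> < real K"
  shows "risk M X Y (oracle_set M X K p \<beta>)
           = (INF \<Gamma> \<in> {\<Gamma> \<in> confidence_sets S K. info M X \<Gamma> = \<beta>}. risk M X Y \<Gamma>)
    \<and> (\<forall>\<Gamma> \<in> confidence_sets S K. info M X \<Gamma> = \<beta> \<longrightarrow>
         0 \<le> risk M X Y \<Gamma> - risk M X Y (oracle_set M X K p \<beta>) \<and>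
         risk M X Y \<Gamma> - risk M X Y (oracle_set M X K p \<beta>)
           = (\<integral>w. (\<Sum>k \<in> sym_diff (oracle_set M X K p \<beta> (X w)) (\<Gamma> (X w)).
                    \<bar>p k (X w) - G_inv M X K p \<beta>\<bar>) \<partial>M))"
proof -
  interpret prob_space M by fact
  interpret continuous_scores M S X Y K p
    using assms by unfold_locales auto
  let ?O = "oracle_set M X K p \<beta>"
  have ge: "0 \<le> risk M X Y \<Gamma> - risk M X Y ?O"
    if "\<Gamma> \<in> confidence_sets S K" "info M X \<Gamma> = \<beta>" for \<Gamma>
    unfolding excess_risk[OF assms(7,8) that]
    by (intro Bochner_Integration.integral_nonneg sum_nonneg) simp
  \<comment> \<open>The oracle set is itself a competitor of information \<open>\<beta>\<close>, so
    the infimum is a minimum attained there.\<close>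
  have "risk M X Y ?O = (INF \<Gamma> \<in> {\<Gamma> \<in> confidence_sets S K. info M X \<Gamma> = \<beta>}. risk M X Y \<Gamma>)"
    using ge oracle_set_confidence_set[OF assms(7,8)] info_oracle_set[OF assms(7,8)]
    by (intro cInf_eq_minimum[symmetric]) auto
  with ge excess_risk[OF assms(7,8)] show ?thesis by auto
qed

end
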